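(* Let $M$ be a grid graph with at least three rows (and at least three columns), with positive integer node weights, and let $s,t$ be nodes of $M$ such that $\{s,t\}$ is not a 2-cut of $M$. Then every minimum-weight $st$-NSC $B$ of $M$ is a non-separating induced $st$-path.
   Context: An $m\times n$ grid graph has node set $\{M_{ij}: 1\leq i\leq m,\ 1\leq j\leq n\}$, with an edge between two nodes consecutive in the same row or the same column. A set $\{s,t\}$ of two nodes is a 2-cut if deleting $s$ and $t$ disconnects the graph. An $st$-NSC (non-separating $st$-connector) is a connected subgraph $B$ containing $s$ and $t$ such that $M-V(B)$ is connected (and nonempty); its weight is the sum of weights of its nodes. A path $P$ is induced if the subgraph induced by $V(P)$ is $P$ itself; it is non-separating if $M-V(P)$ is connected. *)

theory Defs
  imports "Graph_Theory.Digraph_Component"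
begin

text \<open>
  An undirected simple graph is a \<^typ>\<open>'a pair_pre_digraph\<close> with symmetric loop-free arc relation:
  the edge between \<open>u\<close> and \<open>v\<close> is the pair of arcs \<open>(u,v)\<close>, \<open>(v,u)\<close>.
\<close>

definition grid_graph :: "nat \<Rightarrow> nat \<Rightarrow> (nat \<times> nat) pair_pre_digraph" where
  "grid_graph m n =
    \<lparr> pverts = {1..m} \<times> {1..n},
      parcs = {((i, j), (i', j')).
        (i, j) \<in> {1..m} \<times> {1..n} \<and> (i', j') \<in> {1..m} \<times> {1..n} \<and>
        (i = i' \<and> (j' = Suc j \<or> j = Suc j') \<or> j = j' \<and> (i' = Suc i \<or> i = Suc i'))} \<rparr>"

lemma pair_graph_grid_graph: "pair_graph (grid_graph m n)"
proof -
  have "finite (parcs (grid_graph m n))"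
    by (rule finite_subset[of _ "({1..m} \<times> {1..n}) \<times> ({1..m} \<times> {1..n})"])
      (auto simp: grid_graph_def)
  then show ?thesis
    by unfold_locales (auto simp: grid_graph_def symmetric_def intro!: symI)
qed

definition undirected_subgraph :: "'a pair_pre_digraph \<Rightarrow> 'a pair_pre_digraph \<Rightarrow> bool" where
  "undirected_subgraph H G \<longleftrightarrow> subgraph (with_proj H) (with_proj G) \<and> symmetric (with_proj H)"

definition delete_nodes :: "'a pair_pre_digraph \<Rightarrow> 'a set \<Rightarrow> ('a, 'a \<times> 'a) pre_digraph" where
  "delete_nodes G S = with_proj G \<restriction> (pverts G - S)"

text \<open>
  \<^const>\<open>Digraph_Component.connected\<close> includes that the graph has at least one vertex. A graph from
  which everything has been deleted does not count as disconnected in the following definition.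
\<close>

definition two_cut :: "'a pair_pre_digraph \<Rightarrow> 'a \<Rightarrow> 'a \<Rightarrow> bool" where
  "two_cut G s t \<longleftrightarrow> s \<in> pverts G \<and> t \<in> pverts G \<and> s \<noteq> t \<and>
     pverts G - {s, t} \<noteq> {} \<and> \<not> Digraph_Component.connected (delete_nodes G {s, t})"

definition non_separating :: "'a pair_pre_digraph \<Rightarrow> 'a pair_pre_digraph \<Rightarrow> bool" where
  "non_separating G H \<longleftrightarrow> Digraph_Component.connected (delete_nodes G (pverts H))"

definition st_nsc :: "'a pair_pre_digraph \<Rightarrow> 'a \<Rightarrow> 'a \<Rightarrow> 'a pair_pre_digraph \<Rightarrow> bool" where
  "st_nsc G s t B \<longleftrightarrow> undirected_subgraph B G \<and> Digraph_Component.connected (with_proj B) \<and>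
     s \<in> pverts B \<and> t \<in> pverts B \<and> non_separating G B"

definition node_weight :: "('a \<Rightarrow> int) \<Rightarrow> 'a pair_pre_digraph \<Rightarrow> int" where
  "node_weight w B = (\<Sum>v\<in>pverts B. w v)"

definition min_weight_st_nsc ::
  "'a pair_pre_digraph \<Rightarrow> ('a \<Rightarrow> int) \<Rightarrow> 'a \<Rightarrow> 'a \<Rightarrow> 'a pair_pre_digraph \<Rightarrow> bool" where
  "min_weight_st_nsc G w s t B \<longleftrightarrow> is_arg_min (node_weight w) (st_nsc G s t) B"

text \<open>
  \<open>P\<close> itself, as a graph, is a path: \<open>p\<close> traverses all its nodes, each once, and all its edges.
  The path with a single node (\<open>s = t\<close>, \<open>p = []\<close>) is allowed.
\<close>

definition is_st_path :: "'a pair_pre_digraph \<Rightarrow> 'a \<Rightarrow> 'a \<Rightarrow> bool" where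
  "is_st_path P s t \<longleftrightarrow> (\<exists>p. pre_digraph.apath (with_proj P) s p t \<and>
     pverts P = set (pawalk_verts s p) \<and> parcs P = set p \<union> (set p)\<inverse>)"

definition induced_st_path ::
  "'a pair_pre_digraph \<Rightarrow> 'a \<Rightarrow> 'a \<Rightarrow> 'a pair_pre_digraph \<Rightarrow> bool" where
  "induced_st_path G s t P \<longleftrightarrow> is_st_path P s t \<and> induced_subgraph (with_proj P) (with_proj G)"

end

theory Submission
  imports Defs
begin

text \<open>
  Let \<open>X\<close> be the node set of a minimum-weight connector and \<open>r\<close> a node outside \<open>X\<close>. Among the induced
  \<open>st\<close>-paths \<open>p\<close> inside \<open>X\<close> choose one for which the component \<open>C0\<close> of \<open>r\<close> in the complement of \<open>p\<close> is
  largest. No neighbour of \<open>C0\<close> on \<open>p\<close> lies strictly between two neighbours of another component \<open>C\<close>: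
  otherwise \<open>p\<close> could be rerouted through \<open>C\<close>, which lies in \<open>X\<close>, and \<open>C0\<close> would grow. Hence, if there
  is a second component \<open>C\<close>, the segment of \<open>p\<close> between the neighbours \<open>a\<close>, \<open>b\<close> of \<open>C0\<close> (or ends of \<open>p\<close>)
  closest to \<open>C\<close> is, with all the components hanging off it, cut off from \<open>C0\<close> by \<open>{a, b}\<close>. A 2-cut of
  a grid only cuts off a corner, whose two neighbours are not adjacent; this leaves
  \<open>C0\<close> as the corner and \<open>{a, b} = {s, t}\<close>, contrary to the assumption on \<open>s\<close> and \<open>t\<close>. So \<open>p\<close> is
  non-separating, and by minimality it is all of \<open>X\<close>.
\<close>

section \<open>Induced paths\<close>

text \<open>Reflexive even at points outside \<open>S\<close>, so membership in \<open>S\<close> is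
  tracked separately.\<close>

definition reach_in :: "'a rel \<Rightarrow> 'a set \<Rightarrow> 'a rel" where
  "reach_in E S = (E \<inter> S \<times> S)\<^sup>*"

definition conn_in :: "'a rel \<Rightarrow> 'a set \<Rightarrow> bool" where
  "conn_in E S \<longleftrightarrow> (\<forall>x\<in>S. \<forall>y\<in>S. (x, y) \<in> reach_in E S)"

text \<open>A single equivalence over pairs of positions encodes the edges in both directions, the
  absence of chords and the absence of loops.\<close>

definition induced_path :: "'a rel \<Rightarrow> 'a list \<Rightarrow> bool" where
  "induced_path E p \<longleftrightarrow> p \<noteq> [] \<and> distinct p \<and>
     (\<forall>i<length p. \<forall>j<length p. (p ! i, p ! j) \<in> E \<longleftrightarrow> j = Suc i \<or> i = Suc j)"

lemma reach_in_mono: "S \<subseteq> T \<Longrightarrow> reach_in E S \<subseteq> reach_in E T"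
  unfolding reach_in_def by (rule rtrancl_mono) blast

lemma reach_in_refl [simp]: "(x, x) \<in> reach_in E S"
  by (simp add: reach_in_def)

lemma reach_in_trans: "(x, y) \<in> reach_in E S \<Longrightarrow> (y, z) \<in> reach_in E S \<Longrightarrow> (x, z) \<in> reach_in E S"
  unfolding reach_in_def by (rule rtrancl_trans)

lemma reach_in_edge: "(x, y) \<in> E \<Longrightarrow> x \<in> S \<Longrightarrow> y \<in> S \<Longrightarrow> (x, y) \<in> reach_in E S"
  unfolding reach_in_def by blast

lemma reach_in_sym: "sym E \<Longrightarrow> (x, y) \<in> reach_in E S \<Longrightarrow> (y, x) \<in> reach_in E S"
proof -
  assume "sym E" "(x, y) \<in> reach_in E S"
  then have "sym (E \<inter> S \<times> S)" by (auto simp: sym_def)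
  then show ?thesis
    using \<open>(x, y) \<in> reach_in E S\<close> unfolding reach_in_def by (meson sym_rtrancl symD)
qed

lemma reach_in_memD: "(x, y) \<in> reach_in E S \<Longrightarrow> x \<in> S \<Longrightarrow> y \<in> S"
  unfolding reach_in_def by (induction rule: rtrancl_induct) auto

lemma reach_in_Image_subset: "x \<in> S \<Longrightarrow> reach_in E S `` {x} \<subseteq> S"
  by (auto dest: reach_in_memD)

lemma reach_in_closed:
  assumes "(x, y) \<in> reach_in E S" "x \<in> A" "\<And>u v. (u, v) \<in> E \<Longrightarrow> u \<in> A \<Longrightarrow> u \<in> S \<Longrightarrow> v \<in> S \<Longrightarrow> v \<in> A"
  shows "y \<in> A"
  using assms(1) unfolding reach_in_def by (induction rule: rtrancl_induct) (use assms in auto)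

text \<open>A walk stays inside the component of its start, so it survives when \<open>S\<close> is
  replaced by any set containing that component.\<close>

lemma reach_in_component:
  assumes "(x, y) \<in> reach_in E S"
  shows "(x, y) \<in> reach_in E (reach_in E S `` {x})"
  using assms unfolding reach_in_def
proof (induction rule: rtrancl_induct)
  case (step y z)
  then have "(x, z) \<in> (E \<inter> S \<times> S)\<^sup>*" by (meson rtrancl.rtrancl_into_rtrancl)
  then show ?case using step
    by (intro rtrancl.rtrancl_into_rtrancl[OF step.IH]) auto
qed simp

lemma conn_inI: "sym E \<Longrightarrow> (\<And>x. x \<in> S \<Longrightarrow> (r, x) \<in> reach_in E S) \<Longrightarrow> conn_in E S"
  unfolding conn_in_def by (meson reach_in_sym reach_in_trans)

lemma induced_path_take:
  "induced_path E p \<Longrightarrow> k < length p \<Longrightarrow> induced_path E (take (Suc k) p)"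
  unfolding induced_path_def by auto

text \<open>Induction along a walk: if the next node \<open>z\<close> is already on the path, the
  path is truncated there; otherwise it is cut back before \<open>z\<close> is appended, so that no
  chord arises.\<close>

lemma ex_induced_path:
  assumes "sym E" "irrefl E" "s \<in> S" "(s, t) \<in> reach_in E S"
  shows "\<exists>p. induced_path E p \<and> hd p = s \<and> last p = t \<and> set p \<subseteq> S"
  using assms(4) unfolding reach_in_def
proof (induction rule: rtrancl_induct)
  case base
  show ?case
    using assms by (intro exI[of _ "[s]"]) (auto simp: induced_path_def irrefl_def)
next
  case (step y z)
  then obtain p where p: "induced_path E p" "hd p = s" "last p = y" "set p \<subseteq> S" by blast
  then have ne: "p \<noteq> []" by (simp add: induced_path_def)
  have z: "z \<in> S" "(y, z) \<in> E" using step by auto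
  show ?case
  proof (cases "z \<in> set p")
    case True
    then obtain k where k: "k < length p" "p ! k = z" by (auto simp: in_set_conv_nth)
    have "last (take (Suc k) p) = z" using k by (simp add: take_Suc_conv_app_nth)
    moreover have "hd (take (Suc k) p) = s" using p(2) by simp
    moreover have "set (take (Suc k) p) \<subseteq> S" using p(4) set_take_subset by fast
    ultimately show ?thesis using induced_path_take[OF p(1) k(1)] by blast
  next
    case False
    \<comment> \<open>Attaching \<open>z\<close> at its first neighbour on \<open>p\<close> leaves
      no edge from \<open>z\<close> to an earlier node.\<close>
    define k where "k = (LEAST k. k < length p \<and> (p ! k, z) \<in> E)"
    have ex: "length p - 1 < length p \<and> (p ! (length p - 1), z) \<in> E"
      using ne z p(3) by (simp add: last_conv_nth)
    have k: "k < length p" "(p ! k, z) \<in> E"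
      using LeastI[of "\<lambda>k. k < length p \<and> (p ! k, z) \<in> E", OF ex] by (auto simp: k_def)
    have min: "(p ! i, z) \<notin> E" if "i < k" for i
      using not_less_Least[OF that[unfolded k_def]] that k(1) by auto
    have min': "(z, p ! i) \<notin> E" if "i < k" for i
      using min[OF that] assms(1) by (meson symD)
    have zz: "(z, z) \<notin> E" "(z, p ! k) \<in> E"
      using assms(1,2) k by (auto simp: irrefl_def dest: symD)
    let ?q = "take (Suc k) p @ [z]"
    have "induced_path E ?q"
      unfolding induced_path_def
    proof (intro conjI allI impI)
      show "distinct ?q" using p(1) False by (auto simp: induced_path_def dest: in_set_takeD)
      fix i j assume "i < length ?q" "j < length ?q"
      then have ij: "i \<le> Suc k" "j \<le> Suc k" using k by auto
      have n: "?q ! i = (if i \<le> k then p ! i else z)" if "i \<le> Suc k" for i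
        using k(1) that by (auto simp: nth_append)
      show "(?q ! i, ?q ! j) \<in> E \<longleftrightarrow> j = Suc i \<or> i = Suc j"
        unfolding n[OF ij(1)] n[OF ij(2)]
        using p(1) k ij zz min[of i] min'[of j] unfolding induced_path_def
        by (cases "i = k"; cases "j = k"; cases "i = Suc k"; cases "j = Suc k") auto
    qed simp
    moreover have "set ?q \<subseteq> S" using p(4) z(1) set_take_subset[of "Suc k" p] by auto
    moreover have "hd ?q = s" using ne p(2) by (simp add: hd_append)
    ultimately show ?thesis by (intro exI[of _ ?q]) simp
  qed
qed

lemma induced_path_reach_in:
  assumes "induced_path E p" "i \<le> j" "j < length p" "\<And>k. i \<le> k \<Longrightarrow> k \<le> j \<Longrightarrow> p ! k \<in> S"
  shows "(p ! i, p ! j) \<in> reach_in E S"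
  using assms(2,3,4)
proof (induction j rule: dec_induct)
  case (step j)
  have "(p ! j, p ! Suc j) \<in> E" using assms(1) step by (simp add: induced_path_def)
  then have "(p ! j, p ! Suc j) \<in> reach_in E S" using step by (intro reach_in_edge) auto
  then show ?case using step by (meson reach_in_trans Suc_lessD le_SucI)
qed simp

section \<open>Graphs whose 2-cuts only cut off corners\<close>

text \<open>
  In \<open>small_side\<close>, \<open>Q\<close> is one side of the separator \<open>{a, b}\<close>. The case \<open>a = b\<close> is included, so the axiom
  also excludes cut vertices and disconnected graphs.
\<close>

locale corner_cuts =
  fixes V :: "'a set" and E :: "'a rel"
  assumes finite_V: "finite V" and E_sub: "E \<subseteq> V \<times> V" and sym_E: "sym E" and irrefl_E: "irrefl E"
    and small_side: "\<And>Q a b. \<lbrakk>Q \<subseteq> V; a \<in> V; b \<in> V; Q \<noteq> {}; a \<notin> Q; b \<notin> Q; V - Q - {a, b} \<noteq> {};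
      \<And>x y. (x, y) \<in> E \<Longrightarrow> x \<in> Q \<Longrightarrow> y \<in> Q \<union> {a, b}\<rbrakk> \<Longrightarrow>
      a \<noteq> b \<and> (a, b) \<notin> E \<and> (card Q = 1 \<or> card (V - Q - {a, b}) = 1)"
begin

text \<open>The walk along \<open>p\<close> to position \<open>x\<close>, through the component of
  \<open>c\<close>, and along \<open>p\<close> from position \<open>y\<close> stays in
  \<open>X\<close> and avoids both \<open>p ! d\<close> and the component of \<open>r\<close>. An
  induced path within it adds \<open>p ! d\<close> to that component, against
  \<open>max\<close>.\<close>

lemma reroute:
  assumes p: "induced_path E p" "set p \<subseteq> X" "X \<subseteq> V"
    and r: "r \<in> V - X" "conn_in E (V - X)"
    and max: "\<And>q. induced_path E q \<Longrightarrow> hd q = hd p \<Longrightarrow> last q = last p \<Longrightarrow> set q \<subseteq> X \<Longrightarrow>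
       card (reach_in E (V - set q) `` {r}) \<le> card (reach_in E (V - set p) `` {r})"
    and d: "x < d" "d < y" "y < length p"
    and c: "c \<in> V - set p" "(r, c) \<notin> reach_in E (V - set p)" "(c, c') \<in> reach_in E (V - set p)"
      "(p ! x, c) \<in> E" "(c', p ! y) \<in> E"
    and c0: "(r, c0) \<in> reach_in E (V - set p)" "(c0, p ! d) \<in> E"
  shows False
proof -
  let ?W = "V - set p"
  let ?C0 = "reach_in E ?W `` {r}"
  let ?K = "reach_in E ?W `` {c}"
  define S where "S = set (take (Suc x) p) \<union> ?K \<union> set (drop y p)"
  have ne: "p \<noteq> []" and dist: "distinct p" using p(1) by (auto simp: induced_path_def)
  have rW: "r \<in> ?W" using r p by auto
  have C0W: "?C0 \<subseteq> ?W" and CW: "?K \<subseteq> ?W"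
    using rW c(1) by (simp_all only: reach_in_Image_subset)
  have CC0: "?K \<inter> ?C0 = {}"
  proof -
    have "(r, c) \<in> reach_in E ?W" if "(c, z) \<in> reach_in E ?W" "(r, z) \<in> reach_in E ?W" for z
      by (rule reach_in_trans[OF that(2) reach_in_sym[OF sym_E that(1)]])
    then show ?thesis using c(2) by blast
  qed
  \<comment> \<open>The connected set \<open>V - X\<close> contains \<open>r\<close> and avoids
    \<open>p\<close>, hence lies in the component of \<open>r\<close>; every other component is
    therefore inside \<open>X\<close>.\<close>
  have "V - X \<subseteq> ?C0"
  proof
    fix z assume "z \<in> V - X"
    then have "(r, z) \<in> reach_in E (V - X)" using r by (auto simp: conn_in_def)
    then show "z \<in> ?C0" using reach_in_mono[of "V - X" ?W E] p(2) by auto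
  qed
  then have CX: "?K \<subseteq> X" using CC0 CW by blast
  have SX: "S \<subseteq> X"
    using CX p(2) unfolding S_def by (auto dest: in_set_takeD in_set_dropD)
  have SC0: "S \<inter> ?C0 = {}"
    using CC0 C0W unfolding S_def by (auto dest: in_set_takeD in_set_dropD)
  have pk: "p ! k \<in> S" if "k \<le> x \<or> y \<le> k \<and> k < length p" for k
  proof -
    have "k < length p" using that d by auto
    moreover have "p ! k \<in> set (take (Suc x) p)" if "k \<le> x"
      using that d nth_mem[of k "take (Suc x) p"] by simp
    moreover have "p ! k \<in> set (drop y p)" if "y \<le> k" "k < length p"
      using that nth_mem[of "k - y" "drop y p"] by simp
    ultimately show ?thesis using that unfolding S_def by auto
  qed
  have pd: "p ! d \<notin> S"
  proof -
    have uniq: "k = d" if "k < length p" "p ! k = p ! d" for k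
      using that dist d by (simp add: nth_eq_iff_index_eq)
    have "p ! d \<notin> set (take (Suc x) p)"
    proof
      assume "p ! d \<in> set (take (Suc x) p)"
      then obtain i where "i < Suc x" "i < length p" "p ! i = p ! d" by (auto simp: in_set_conv_nth)
      then show False using uniq[of i] d by simp
    qed
    moreover have "p ! d \<notin> set (drop y p)"
    proof
      assume "p ! d \<in> set (drop y p)"
      then obtain i where "y + i < length p" "p ! (y + i) = p ! d"
        by (auto simp: in_set_conv_nth less_diff_conv add.commute)
      then show False using uniq[of "y + i"] d by simp
    qed
    moreover have "p ! d \<notin> ?K" using CW d by (meson DiffD2 nth_mem order.strict_trans subsetD)
    ultimately show ?thesis unfolding S_def by blast
  qed
  have cS: "c \<in> S" "c' \<in> S" using c(3) unfolding S_def by auto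
  have "(p ! 0, p ! x) \<in> reach_in E S"
    by (rule induced_path_reach_in[OF p(1)]) (use d pk in auto)
  also have "(p ! x, c) \<in> reach_in E S" using c(4) cS pk by (intro reach_in_edge) auto
  also (reach_in_trans) have "(c, c') \<in> reach_in E S"
    using reach_in_component[OF c(3)] reach_in_mono[of ?K S E] unfolding S_def by blast
  also (reach_in_trans) have "(c', p ! y) \<in> reach_in E S"
    using c(5) cS pk d by (intro reach_in_edge) auto
  also (reach_in_trans) have "(p ! y, p ! (length p - 1)) \<in> reach_in E S"
    by (rule induced_path_reach_in[OF p(1)]) (use d pk in auto)
  finally (reach_in_trans) have "(hd p, last p) \<in> reach_in E S"
    using ne by (simp add: hd_conv_nth last_conv_nth)
  moreover have "hd p \<in> S" using pk[of 0] ne by (simp add: hd_conv_nth)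
  ultimately obtain q where q: "induced_path E q" "hd q = hd p" "last q = last p" "set q \<subseteq> S"
    using ex_induced_path[OF sym_E irrefl_E] by blast
  have "?C0 \<subseteq> V - set q" using C0W SC0 q(4) by blast
  then have sub: "?C0 \<subseteq> reach_in E (V - set q) `` {r}"
    using reach_in_component[of r _ E ?W] reach_in_mono[of ?C0 "V - set q" E] by blast
  have "p ! d \<in> V - set q" using pd q(4) E_sub c0(2) by auto
  then have "(c0, p ! d) \<in> reach_in E (V - set q)"
    using c0 \<open>?C0 \<subseteq> V - set q\<close> by (intro reach_in_edge) auto
  then have "p ! d \<in> reach_in E (V - set q) `` {r}"
    using sub c0(1) reach_in_trans[of r c0] by blast
  moreover have "p ! d \<notin> ?C0" using C0W d by (meson DiffD2 nth_mem order.strict_trans subsetD)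
  ultimately have "?C0 \<subset> reach_in E (V - set q) `` {r}" using sub by blast
  moreover have "reach_in E (V - set q) `` {r} \<subseteq> V"
    using reach_in_Image_subset[of r "V - set q" E] q(4) SX r(1) by blast
  ultimately have "card ?C0 < card (reach_in E (V - set q) `` {r})"
    using finite_V by (meson finite_subset psubset_card_mono)
  then show False using max[OF q(1-3)] q(4) SX by auto
qed

theorem ex_non_separating_induced_path:
  assumes X: "X \<subseteq> V" "conn_in E X" "s \<in> X" "t \<in> X" "V - X \<noteq> {}" "conn_in E (V - X)"
    and st: "s \<noteq> t \<Longrightarrow> conn_in E (V - {s, t})"
  shows "\<exists>p. induced_path E p \<and> hd p = s \<and> last p = t \<and> set p \<subseteq> X \<and> conn_in E (V - set p)"
proof -
  obtain r where r: "r \<in> V - X" using X(5) by blast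

  \<comment> \<open>Extremal choice of the path\<close>
  let ?good = "\<lambda>p. induced_path E p \<and> hd p = s \<and> last p = t \<and> set p \<subseteq> X"
  let ?size = "\<lambda>p. card (reach_in E (V - set p) `` {r})"
  have "(s, t) \<in> reach_in E X" using X by (auto simp: conn_in_def)
  then obtain p0 where p0: "?good p0" using ex_induced_path[OF sym_E irrefl_E X(3)] by blast
  have bound: "?size p \<le> card V" if "?good p" for p
    using that r reach_in_Image_subset[of r "V - set p" E] by (intro card_mono[OF finite_V]) blast
  have "\<exists>p. ?good p \<and> (\<forall>q. ?good q \<longrightarrow> ?size q \<le> ?size p)"
    by (rule ex_has_greatest_nat[of ?good p0 ?size "Suc (card V)"]) (use p0 bound in \<open>auto simp: less_Suc_eq_le\<close>)
  then obtain p where p: "?good p" and max: "\<And>q. ?good q \<Longrightarrow> ?size q \<le> ?size p" by auto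
  have ne: "p \<noteq> []" and dist: "distinct p"
    and adj: "\<And>i j. i < length p \<Longrightarrow> j < length p \<Longrightarrow> (p ! i, p ! j) \<in> E \<longleftrightarrow> j = Suc i \<or> i = Suc j"
    using p by (auto simp: induced_path_def)
  let ?n = "length p"
  let ?W = "V - set p"
  define C0 where "C0 = reach_in E ?W `` {r}"
  have rW: "r \<in> ?W" using r p by auto
  have pV: "p ! i \<in> V" if "i < ?n" for i using nth_mem[OF that] p X(1) by blast
  have C0W: "C0 \<subseteq> ?W" unfolding C0_def using rW by (rule reach_in_Image_subset)
  have "?W \<subseteq> C0"
  proof (rule ccontr)
    assume "\<not> ?W \<subseteq> C0"
    then obtain q where q: "q \<in> ?W" "q \<notin> C0" by blast
    \<comment> \<open>positions on \<open>p\<close> of the neighbours of the component of \<open>c\<close>\<close>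
    define att where "att c = {k. k < ?n \<and> (\<exists>c'. (c, c') \<in> reach_in E ?W \<and> (c', p ! k) \<in> E)}" for c
    have att_lt: "k < ?n" if "k \<in> att c" for k c using that by (simp add: att_def)
    have key: False if h: "c \<in> ?W" "c \<notin> C0" "x \<in> att c" "y \<in> att c" "d \<in> att r" "x < d" "d < y" for c x d y
    proof -
      obtain c1 where c1: "(c, c1) \<in> reach_in E ?W" "(c1, p ! x) \<in> E" using h(3) unfolding att_def by blast
      obtain c2 where c2: "(c, c2) \<in> reach_in E ?W" "(c2, p ! y) \<in> E" using h(4) unfolding att_def by blast
      obtain c0 where c0: "(r, c0) \<in> reach_in E ?W" "(c0, p ! d) \<in> E" using h(5) unfolding att_def by blast
      show False
      proof (rule reroute[of p X r x d y c1 c2 c0])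
        show "induced_path E p" "set p \<subseteq> X" "X \<subseteq> V" "r \<in> V - X" "conn_in E (V - X)"
          using p X r by blast+
        show "?size q' \<le> ?size p"
          if "induced_path E q'" "hd q' = hd p" "last q' = last p" "set q' \<subseteq> X" for q'
          by (rule max) (use that p in simp)
        show "x < d" "d < y" "y < length p" using h att_lt by blast+
        show "(c1, c2) \<in> reach_in E ?W"
          by (rule reach_in_trans[OF reach_in_sym[OF sym_E c1(1)] c2(1)])
        show "c1 \<in> ?W" by (rule reach_in_memD[OF c1(1) h(1)])
        show "(r, c1) \<notin> reach_in E ?W"
          using reach_in_trans[OF _ reach_in_sym[OF sym_E c1(1)], of r] h(2) unfolding C0_def by blast
        show "(p ! x, c1) \<in> E" by (rule symD[OF sym_E c1(2)])
      qed (fact c2(2) c0)+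
    qed
    \<comment> \<open>A component without attachments is cut off from \<open>s\<close> by nothing at
      all; \<open>small_side\<close> with both separator nodes equal to \<open>s\<close> turns this
      into \<open>s \<noteq> s\<close>.\<close>
    have connV: "att q \<noteq> {}"
    proof
      assume empty: "att q = {}"
      let ?Q = "reach_in E ?W `` {q}"
      have QW: "?Q \<subseteq> ?W" using q(1) by (rule reach_in_Image_subset)
      have s: "s \<in> set p" using p ne by auto
      have "s \<noteq> s"
      proof (rule small_side[of ?Q s s, THEN conjunct1])
        fix x y assume xy: "(x, y) \<in> E" "x \<in> ?Q"
        have "y \<notin> set p"
          using empty xy unfolding att_def in_set_conv_nth by blast
        then have "(x, y) \<in> reach_in E ?W" using xy QW E_sub by (intro reach_in_edge) auto
        then show "y \<in> ?Q \<union> {s, s}" using xy(2) reach_in_trans[of q x E ?W y] by blast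
      next
        have "r \<notin> ?Q" using q(2) reach_in_sym[OF sym_E, of q r] unfolding C0_def by blast
        then show "V - ?Q - {s, s} \<noteq> {}" using rW s by auto
      next
        show "?Q \<noteq> {}" using reach_in_refl[of q E ?W] by blast
      qed (use QW s X in blast)+
      then show False by simp
    qed

    \<comment> \<open>The segment of the path facing the second component\<close>
    define D1 where "D1 = {d \<in> att r. \<forall>k\<in>att q. d \<le> k}"
    define D2 where "D2 = {d \<in> att r. \<forall>k\<in>att q. k \<le> d}"
    \<comment> \<open>By \<open>key\<close>, no attachment of \<open>C0\<close> lies strictly
      between two attachments of the component of \<open>q\<close>.\<close>
    have D: "att r = D1 \<union> D2"
    proof -
      have "d \<in> D1 \<union> D2" if d: "d \<in> att r" for d
      proof (rule ccontr)
        assume "d \<notin> D1 \<union> D2"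
        then obtain x y where "x \<in> att q" "x < d" "y \<in> att q" "d < y"
          using d unfolding D1_def D2_def by (auto simp: not_le)
        then show False using key[OF q _ _ d] by blast
      qed
      then show ?thesis unfolding D1_def D2_def by blast
    qed
    have fin: "finite D1" "finite D2"
      unfolding D1_def D2_def att_def by simp_all
    \<comment> \<open>The inserted values \<open>0\<close> and \<open>?n - 1\<close> make the ends
      of \<open>p\<close> the default when \<open>C0\<close> has no attachment on that side.\<close>
    define a where "a = Max (insert 0 D1)"
    define b where "b = Min (insert (?n - 1) D2)"
    have a: "a = 0 \<or> a \<in> D1" "\<And>d. d \<in> D1 \<Longrightarrow> d \<le> a"
      using Max_in[of "insert 0 D1"] fin unfolding a_def by auto
    have b: "b = ?n - 1 \<or> b \<in> D2" "\<And>d. d \<in> D2 \<Longrightarrow> b \<le> d"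
      using Min_in[of "insert (?n - 1) D2"] fin unfolding b_def by auto
    have ak: "a \<le> k" if "k \<in> att q" for k using a(1) that unfolding D1_def by auto
    have kb: "k \<le> b" if "k \<in> att q" for k using b(1) that att_lt[OF that] unfolding D2_def by auto
    have ab: "a \<le> b" using connV ak kb by (meson equals0I le_trans)
    have bn: "b < ?n" using b(1) ne att_lt unfolding D2_def by auto
    have gap: "d \<le> a \<or> b \<le> d" if "d \<in> att r" for d using that D a(2) b(2) by blast
    have a': "a = 0 \<or> a \<in> att r" using a(1) D by blast
    have b': "b = ?n - 1 \<or> b \<in> att r" using b(1) D by blast
    define Q where "Q = {p ! k |k. a < k \<and> k < b} \<union> {c \<in> ?W - C0. att c \<subseteq> {a..b}}"
    have idx: "p ! i = p ! j \<longleftrightarrow> i = j" if "i < ?n" "j < ?n" for i j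
      using that dist by (simp add: nth_eq_iff_index_eq)
    have pQ: "p ! i \<in> Q \<longleftrightarrow> a < i \<and> i < b" if "i < ?n" for i
      using that idx bn unfolding Q_def by auto
    have att_eq: "att c = att c'" if "(c, c') \<in> reach_in E ?W" for c c'
    proof -
      have "(c, z) \<in> reach_in E ?W \<longleftrightarrow> (c', z) \<in> reach_in E ?W" for z
        using reach_in_trans[OF that, of z] reach_in_trans[OF reach_in_sym[OF sym_E that], of z] by blast
      then show ?thesis unfolding att_def by simp
    qed
    \<comment> \<open>By \<open>gap\<close>, an inner node of the segment has no neighbour in
      \<open>C0\<close>. A component attached to such a node cannot also attach outside
      \<open>{a..b}\<close>: then \<open>a\<close> or \<open>b\<close> would be an attachment of
      \<open>C0\<close> strictly between two of its own, against \<open>key\<close>. If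
      \<open>a\<close> or \<open>b\<close> is an end of \<open>p\<close>, nothing lies beyond
      it.\<close>
    have nbr: "y \<in> Q \<union> {p ! a, p ! b}" if xy: "(x, y) \<in> E" "x \<in> Q" for x y
    proof (cases "y \<in> set p")
      case True
      then obtain j where j: "j < ?n" "y = p ! j" by (auto simp: in_set_conv_nth)
      have "a \<le> j \<and> j \<le> b"
      proof (cases "x \<in> set p")
        case True
        then obtain i where i: "i < ?n" "x = p ! i" by (auto simp: in_set_conv_nth)
        then show ?thesis using xy pQ[of i] adj[of i j] j by auto
      next
        case False
        then have "att x \<subseteq> {a..b}" using xy(2) bn unfolding Q_def by auto
        moreover have "j \<in> att x" using xy(1) j unfolding att_def using reach_in_refl[of x E ?W] by blast
        ultimately show ?thesis by auto
      qed
      then show ?thesis using pQ[OF j(1)] j(2) by (cases "j = a"; cases "j = b") auto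
    next
      case False
      then have yW: "y \<in> ?W" using xy E_sub by auto
      show ?thesis
      proof (cases "x \<in> set p")
        case True
        then obtain i where i: "i < ?n" "x = p ! i" by (auto simp: in_set_conv_nth)
        then have iab: "a < i" "i < b" using xy pQ by auto
        have yx: "(y, p ! i) \<in> E" using xy i sym_E by (meson symD)
        then have iy: "i \<in> att y" using i(1) reach_in_refl[of y E ?W] unfolding att_def by blast
        have "y \<notin> C0"
        proof
          assume "y \<in> C0"
          then have "i \<in> att r" using i(1) yx unfolding C0_def att_def by blast
          then show False using gap iab by force
        qed
        moreover have "att y \<subseteq> {a..b}"
        proof (rule subsetI, rule ccontr)
          fix k assume k: "k \<in> att y" "k \<notin> {a..b}"
          then consider "k < a" | "b < k" by force
          then show False
          proof cases
            case 1
            then show False using a' key[OF yW \<open>y \<notin> C0\<close> k(1) iy _ 1 iab(1)] by auto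
          next
            case 2
            then show False using b' att_lt[OF k(1)] key[OF yW \<open>y \<notin> C0\<close> iy k(1) _ iab(2) 2] by auto
          qed
        qed
        ultimately show ?thesis using yW unfolding Q_def by auto
      next
        case False
        then have x: "x \<in> ?W" "x \<notin> C0" "att x \<subseteq> {a..b}" using xy(2) bn unfolding Q_def by auto
        have r1: "(x, y) \<in> reach_in E ?W" using xy x yW by (intro reach_in_edge) auto
        have "y \<notin> C0"
          using x(2) reach_in_trans[OF _ reach_in_sym[OF sym_E r1], of r] unfolding C0_def by blast
        then show ?thesis using yW x(3) att_eq[OF r1] unfolding Q_def by auto
      qed
    qed

    \<comment> \<open>Contradiction from the cut\<close>
    have qQ: "q \<in> Q" using q ak kb unfolding Q_def by auto
    have rC0: "r \<in> C0" by (simp add: C0_def)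
    have rQ: "r \<in> V - Q - {p ! a, p ! b}"
    proof -
      have "r \<notin> set p" using rW by auto
      then show ?thesis using rC0 rW ab bn unfolding Q_def by auto
    qed
    have QV: "Q \<subseteq> V" using pV bn unfolding Q_def by auto
    have small: "p ! a \<noteq> p ! b \<and> (p ! a, p ! b) \<notin> E \<and> (card Q = 1 \<or> card (V - Q - {p ! a, p ! b}) = 1)"
      by (rule small_side[OF QV]) (use nbr qQ rQ pQ pV ab bn in auto)
    \<comment> \<open>Distinct nonadjacent nodes of an induced path have a node between them. So
      \<open>Q\<close> contains that node besides \<open>q\<close>, and the single node must be on
      the other side, where it is \<open>r\<close>.\<close>
    then have "a \<noteq> b" "b \<noteq> Suc a" using adj[of a b] ab bn by auto
    then have ab2: "Suc a < b" using ab by auto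
    have "{q, p ! Suc a} \<subseteq> Q" using qQ pQ[of "Suc a"] ab2 bn by auto
    moreover have "q \<noteq> p ! Suc a" using q ab2 bn by auto
    moreover have "finite Q" using QV finite_V finite_subset by blast
    ultimately have "card Q \<noteq> 1" by (metis card_1_singletonE doubleton_eq_iff insert_subset singletonD)
    then have "card (V - Q - {p ! a, p ! b}) = 1" using small by blast
    then have R: "V - Q - {p ! a, p ! b} = {r}" using rQ by (metis card_1_singletonE singletonD)
    have cover: "a \<le> i \<and> i \<le> b" if i: "i < ?n" for i
    proof -
      have "p ! i \<noteq> r" using rW nth_mem[OF i] by blast
      then have "p ! i \<in> Q \<union> {p ! a, p ! b}" using R pV[OF i] by blast
      then show ?thesis using pQ[OF i] idx[OF i] ab bn by auto
    qed
    have "a = 0" "b = ?n - 1" using cover[of 0] cover[of "?n - 1"] ne bn by auto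
    then have ends: "p ! a = s" "p ! b = t"
      using p ne by (auto simp: hd_conv_nth last_conv_nth)
    \<comment> \<open>Every walk that leaves \<open>Q\<close> must pass through \<open>s\<close> or
      \<open>t\<close>, so none from \<open>q\<close> reaches \<open>r\<close> once these are
      deleted.\<close>
    then have "conn_in E (V - {s, t})" using st small by auto
    moreover have "q \<in> V - {s, t}" using q ends ab bn by auto
    moreover have "r \<in> V - {s, t}" using rQ ends by auto
    ultimately have "(q, r) \<in> reach_in E (V - {s, t})" by (simp add: conn_in_def)
    then have "r \<in> Q"
      by (rule reach_in_closed) (use qQ nbr ends in auto)
    then show False using rQ by auto
  qed
  then have "conn_in E ?W" by (intro conn_inI[OF sym_E, of _ r]) (auto simp: C0_def)
  then show ?thesis using p by blast
qed

end

section \<open>Cuts of the grid\<close>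

text \<open>
  A row avoiding \<open>a\<close> and \<open>b\<close> lies on one side of the cut, and so does such a column. As rows and columns
  meet, all of them are on the same side \<open>S\<close>, and only the two other corners of the rectangle spanned
  by \<open>a\<close> and \<open>b\<close> can be on the side \<open>T\<close>. If both are, the grid is \<open>2 \<times> 2\<close>.
\<close>

lemma grid_small_side:
  fixes m n :: nat
  defines "V \<equiv> {1..m} \<times> {1..n}" and "E \<equiv> parcs (grid_graph m n)"
  assumes mn: "m \<ge> 3" "n \<ge> 3"
    and Q: "Q \<subseteq> V" "a \<in> V" "b \<in> V" "Q \<noteq> {}" "a \<notin> Q" "b \<notin> Q" "V - Q - {a, b} \<noteq> {}"
    and nbr: "\<And>x y. (x, y) \<in> E \<Longrightarrow> x \<in> Q \<Longrightarrow> y \<in> Q \<union> {a, b}"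
  shows "a \<noteq> b \<and> (a, b) \<notin> E \<and> (card Q = 1 \<or> card (V - Q - {a, b}) = 1)"
proof -
  obtain a1 a2 b1 b2 where ab: "a = (a1, a2)" "b = (b1, b2)" by (cases a, cases b)
  have E: "((i, j), (i', j')) \<in> E \<longleftrightarrow> (i, j) \<in> V \<and> (i', j') \<in> V \<and>
    (i = i' \<and> (j' = Suc j \<or> j = Suc j') \<or> j = j' \<and> (i' = Suc i \<or> i = Suc i'))" for i j i' j'
    unfolding E_def V_def grid_graph_def by auto
  have symE: "(x, y) \<in> E \<Longrightarrow> (y, x) \<in> E" for x y
    by (cases x, cases y) (auto simp: E)
  define R where "R = V - Q - {a, b}"
  have nbrR: "y \<in> R \<union> {a, b}" if "(x, y) \<in> E" "x \<in> R" for x y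
    using that nbr[OF symE[OF that(1)]] E Q unfolding R_def by (cases x, cases y) auto
  \<comment> \<open>\<open>S\<close> is the side containing the crossing of a row and a column that
    avoid \<open>a\<close> and \<open>b\<close>. Either side of the cut may be that one, hence the
    general \<open>S\<close> and \<open>T\<close>.\<close>
  have main: "a \<noteq> b \<and> (a, b) \<notin> E \<and> card T = 1"
    if S: "S \<union> T = V - {a, b}" "S \<inter> T = {}" "T \<noteq> {}" "(i0, j0) \<in> S" "i0 \<notin> {a1, b1}" "j0 \<notin> {a2, b2}"
      and nS: "\<And>x y. (x, y) \<in> E \<Longrightarrow> x \<in> S \<Longrightarrow> y \<in> S \<union> {a, b}"
      and nT: "\<And>x y. (x, y) \<in> E \<Longrightarrow> x \<in> T \<Longrightarrow> y \<in> T \<union> {a, b}"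
    for S T i0 j0
  proof -
    have SV: "S \<subseteq> V" "T \<subseteq> V" using S(1) by auto
    have Sab: "a \<notin> S" "b \<notin> S" using S(1) by auto
    have row: "(i, j') \<in> S" if h: "(i, j) \<in> S" "i \<notin> {a1, b1}" "j' \<in> {1..n}" for i j j'
    proof -
      have step: "(i, l') \<in> S" if "(i, l) \<in> S" "l' \<in> {1..n}" "l' = Suc l \<or> l = Suc l'" for l l'
        using nS[of "(i, l)" "(i, l')"] that h(2) SV(1) unfolding E ab by (auto simp: V_def)
      have j: "j \<in> {1..n}" using h(1) SV(1) by (auto simp: V_def)
      show ?thesis
      proof (cases "j \<le> j'")
        case True
        then show ?thesis using h(3)
          by (induction j' rule: dec_induct) (use h(1) step j in auto)
      next
        case False
        then have "j' \<le> j" by simp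
        then show ?thesis using h(3)
          by (induction j' rule: inc_induct) (use h(1) step j in auto)
      qed
    qed
    have col: "(i', j) \<in> S" if h: "(i, j) \<in> S" "j \<notin> {a2, b2}" "i' \<in> {1..m}" for i j i'
    proof -
      have step: "(l', j) \<in> S" if "(l, j) \<in> S" "l' \<in> {1..m}" "l' = Suc l \<or> l = Suc l'" for l l'
        using nS[of "(l, j)" "(l', j)"] that h(2) SV(1) unfolding E ab by (auto simp: V_def)
      have i: "i \<in> {1..m}" using h(1) SV(1) by (auto simp: V_def)
      show ?thesis
      proof (cases "i \<le> i'")
        case True
        then show ?thesis using h(3)
          by (induction i' rule: dec_induct) (use h(1) step i in auto)
      next
        case False
        then have "i' \<le> i" by simp
        then show ?thesis using h(3)
          by (induction i' rule: inc_induct) (use h(1) step i in auto)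
      qed
    qed
    \<comment> \<open>From \<open>(i0, j0)\<close>, a node in a free row is reached along column
      \<open>j0\<close> and then that row; a node in a free column is reached along row
      \<open>i0\<close> and then that column.\<close>
    have T: "T \<subseteq> {(a1, b2), (b1, a2)}"
    proof
      fix x assume x: "x \<in> T"
      obtain i j where ij: "x = (i, j)" by (cases x)
      have xV: "i \<in> {1..m}" "j \<in> {1..n}" using x ij SV(2) by (auto simp: V_def)
      have notS: "(i, j) \<notin> S" using x ij S(2) by blast
      have "i \<in> {a1, b1}" using row[OF col[OF S(4,6) xV(1)] _ xV(2)] notS by blast
      moreover have "j \<in> {a2, b2}" using col[OF row[OF S(4,5) xV(2)] _ xV(1)] notS by blast
      moreover have "x \<noteq> a" "x \<noteq> b" using x S(1) by auto
      ultimately show "x \<in> {(a1, b2), (b1, a2)}" using ij ab by auto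
    qed
    \<comment> \<open>If \<open>a\<close> and \<open>b\<close> shared a row or a column, the two
      corners would be \<open>a\<close> and \<open>b\<close> themselves and \<open>T\<close> would
      be empty.\<close>
    have ne: "a1 \<noteq> b1" "a2 \<noteq> b2"
      using T S(1,3) ab by auto
    \<comment> \<open>With both corners in \<open>T\<close>, the only possible neighbour of
      \<open>(a1, b2)\<close> within its column is \<open>b\<close>, and that of
      \<open>(b1, a2)\<close> is \<open>a\<close>. So rows \<open>a1\<close> and \<open>b1\<close>
      are next to each other and to no further row, impossible when
      \<open>m \<ge> 3\<close>.\<close>
    have "\<not> {(a1, b2), (b1, a2)} \<subseteq> T"
    proof
      assume both: "{(a1, b2), (b1, a2)} \<subseteq> T"
      have n1: "b1 = i" if "((a1, b2), (i, b2)) \<in> E" for i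
        using nT[OF that] both T ne that unfolding E ab by auto
      have e1: "Suc a1 \<le> m \<Longrightarrow> b1 = Suc a1" "2 \<le> a1 \<Longrightarrow> Suc b1 = a1"
      proof -
        show "b1 = Suc a1" if "Suc a1 \<le> m"
          by (rule n1) (use that Q(2,3) in \<open>auto simp: E ab V_def\<close>)
        have "b1 = a1 - 1" if "2 \<le> a1"
          by (rule n1) (use that Q(2,3) in \<open>auto simp: E ab V_def\<close>)
        then show "Suc b1 = a1" if "2 \<le> a1" using that by auto
      qed
      have n2: "a1 = i" if "((b1, a2), (i, a2)) \<in> E" for i
        using nT[OF that] both T ne that unfolding E ab by auto
      have e2: "Suc b1 \<le> m \<Longrightarrow> a1 = Suc b1" "2 \<le> b1 \<Longrightarrow> Suc a1 = b1"
      proof -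
        show "a1 = Suc b1" if "Suc b1 \<le> m"
          by (rule n2) (use that Q(2,3) in \<open>auto simp: E ab V_def\<close>)
        have "a1 = b1 - 1" if "2 \<le> b1"
          by (rule n2) (use that Q(2,3) in \<open>auto simp: E ab V_def\<close>)
        then show "Suc a1 = b1" if "2 \<le> b1" using that by auto
      qed
      have "a1 \<le> m" "b1 \<le> m" "1 \<le> a1" "1 \<le> b1" using Q(2,3) ab V_def by auto
      then consider "2 \<le> a1" "Suc a1 \<le> m" | "a1 = 1" | "a1 = m" by linarith
      then show False
      proof cases
        case 1
        then show False using e1 by linarith
      next
        case 2
        then have "b1 = 2" using e1(1) mn(1) by simp
        then show False using \<open>a1 = 1\<close> e2 mn(1) by simp
      next
        case 3
        then have "Suc b1 = m" using e1(2) mn(1) by simp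
        then show False using \<open>a1 = m\<close> e2(2) mn(1) by simp
      qed
    qed
    then have "\<exists>x. T = {x}" using T S(3) by auto
    then have "card T = 1" by auto
    moreover have "a \<noteq> b" "(a, b) \<notin> E" using ne ab E by auto
    ultimately show ?thesis by blast
  qed
  \<comment> \<open>Among three rows one avoids both \<open>a\<close> and \<open>b\<close>, and
    likewise among three columns.\<close>
  have "\<exists>k\<in>{1, 2, 3}. k \<notin> {x, y}" for x y :: nat by auto
  then obtain i0 j0 where free: "i0 \<in> {1, 2, 3}" "i0 \<notin> {a1, b1}" "j0 \<in> {1, 2, 3}" "j0 \<notin> {a2, b2}"
    by meson
  have "(i0, j0) \<in> Q \<union> R" using free mn ab unfolding R_def V_def by auto
  then show ?thesis
  proof
    assume "(i0, j0) \<in> Q"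
    then have "a \<noteq> b \<and> (a, b) \<notin> E \<and> card R = 1"
      by (intro main[of Q R i0 j0]) (use free Q nbr nbrR in \<open>auto simp: R_def\<close>)
    then show ?thesis by (simp add: R_def)
  next
    assume "(i0, j0) \<in> R"
    then have "a \<noteq> b \<and> (a, b) \<notin> E \<and> card Q = 1"
      by (intro main[of R Q i0 j0]) (use free Q nbr nbrR in \<open>auto simp: R_def\<close>)
    then show ?thesis by simp
  qed
qed

section \<open>Minimum-weight connectors\<close>

lemma rtrancl_on_iff_reach_in: "(u, v) \<in> rtrancl_on F r \<longleftrightarrow> u \<in> F \<and> (u, v) \<in> reach_in r F"
proof (intro iffI conjI)
  assume h: "(u, v) \<in> rtrancl_on F r"
  then show "u \<in> F" by (rule in_rtrancl_on_in_F)
  show "(u, v) \<in> reach_in r F" using h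
    by (induction rule: rtrancl_on_induct) (auto intro: reach_in_trans reach_in_edge)
next
  assume "u \<in> F \<and> (u, v) \<in> reach_in r F"
  then have "(u, v) \<in> (r \<inter> F \<times> F)\<^sup>*" "u \<in> F" by (auto simp: reach_in_def)
  then show "(u, v) \<in> rtrancl_on F r"
    by (induction rule: rtrancl_induct) (auto intro: rtrancl_on_into_rtrancl_on)
qed

text \<open>Library connectedness is strong connectedness of the symmetric closure, and a symmetric
  arc relation is its own closure.\<close>

lemma connected_iff_conn_in:
  assumes "sym (arcs_ends G)"
  shows "Digraph_Component.connected G \<longleftrightarrow> verts G \<noteq> {} \<and> conn_in (arcs_ends G) (verts G)"
proof -
  have "parcs (mk_symmetric G) = arcs_ends G \<union> (arcs_ends G)\<inverse>"
    by (auto simp: mk_symmetric_def arcs_ends_conv)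
  then have "parcs (mk_symmetric G) = arcs_ends G"
    using assms by (simp add: sym_conv_converse_eq)
  moreover have "pverts (mk_symmetric G) = verts G" by (simp add: mk_symmetric_def)
  ultimately show ?thesis
    by (auto simp: Digraph_Component.connected_def strongly_connected_def reachable_def
        rtrancl_on_iff_reach_in conn_in_def)
qed

lemma conn_in_Restr: "conn_in (E \<inter> S \<times> S) S \<longleftrightarrow> conn_in E S"
  by (simp add: conn_in_def reach_in_def Int_assoc)

lemma connected_delete_nodes_iff:
  assumes "sym (parcs G)"
  shows "Digraph_Component.connected (delete_nodes G S) \<longleftrightarrow>
    pverts G - S \<noteq> {} \<and> conn_in (parcs G) (pverts G - S)"
proof -
  let ?T = "pverts G - S"
  have ends: "arcs_ends (delete_nodes G S) = parcs G \<inter> ?T \<times> ?T"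
    by (auto simp: delete_nodes_def induce_subgraph_def arcs_ends_conv)
  have "sym (parcs G \<inter> ?T \<times> ?T)" using assms by (auto simp: sym_def)
  then show ?thesis
    by (simp add: connected_iff_conn_in ends) (simp add: delete_nodes_def conn_in_Restr)
qed

text \<open>Translates node lists into the arc lists of the library: \<open>zip q (tl q)\<close>
  lists the consecutive pairs and is empty for a single node.\<close>

lemma induced_path_apath:
  assumes "induced_path (parcs G) q" "set q \<subseteq> pverts G"
  shows "pre_digraph.apath (with_proj G) (hd q) (zip q (tl q)) (last q)"
    and "pawalk_verts (hd q) (zip q (tl q)) = q"
proof -
  have verts: "p \<noteq> [] \<Longrightarrow> pawalk_verts (hd p) (zip p (tl p)) = p" for p :: "'a list"
  proof (induction p)
    case (Cons x p) then show ?case by (cases p) auto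
  qed simp
  have cas: "p \<noteq> [] \<Longrightarrow> pcas (hd p) (zip p (tl p)) (last p)" for p :: "'a list"
  proof (induction p)
    case (Cons x p) then show ?case by (cases p) auto
  qed simp
  have ne: "q \<noteq> []" "distinct q" using assms(1) by (auto simp: induced_path_def)
  show v: "pawalk_verts (hd q) (zip q (tl q)) = q" by (rule verts[OF ne(1)])
  have "set (zip q (tl q)) \<subseteq> parcs G"
    using assms(1) by (auto simp: set_zip nth_tl induced_path_def)
  then show "pre_digraph.apath (with_proj G) (hd q) (zip q (tl q)) (last q)"
    using ne assms(2) v cas[OF ne(1)] hd_in_set[OF ne(1)]
    by (auto simp: pre_digraph.apath_def pre_digraph.awalk_def cas_with_proj_eq awalk_verts_with_proj_eq)
qed

theorem theorem1:
  fixes m n :: nat and w :: "nat \<times> nat \<Rightarrow> int" and s t :: "nat \<times> nat"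
    and B :: "(nat \<times> nat) pair_pre_digraph"
  assumes "m \<ge> 3" and "n \<ge> 3"
    and "\<And>v. v \<in> pverts (grid_graph m n) \<Longrightarrow> w v > 0"
    and "s \<in> pverts (grid_graph m n)" and "t \<in> pverts (grid_graph m n)"
    and "\<not> two_cut (grid_graph m n) s t"
    and "min_weight_st_nsc (grid_graph m n) w s t B"
  shows "induced_st_path (grid_graph m n) s t B \<and> non_separating (grid_graph m n) B"
proof -

  \<comment> \<open>Passage from graphs to relations\<close>
  let ?G = "grid_graph m n"
  define V where "V = pverts ?G"
  define E where "E = parcs ?G"
  interpret G: pair_graph ?G by (rule pair_graph_grid_graph)
  have V: "V = {1..m} \<times> {1..n}" by (simp add: V_def grid_graph_def)
  have finV: "finite V" by (simp add: V)
  have symE: "sym E" using G.pair_sym_arcs by (simp add: E_def symmetric_def)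
  have EV: "E \<subseteq> V \<times> V" by (auto simp: E_def V_def dest: G.wellformed')
  have irE: "irrefl E" by (auto simp: irrefl_def E_def dest: G.pair_no_loops)
  interpret corner_cuts V E
    by (unfold_locales; (fact finV EV symE irE)?; unfold V E_def)
      (rule grid_small_side[OF assms(1,2)]; assumption?; blast)
  define X where "X = pverts B"
  have nsc: "st_nsc ?G s t B" and min: "\<And>P. st_nsc ?G s t P \<Longrightarrow> node_weight w B \<le> node_weight w P"
    using assms(7) by (auto simp: min_weight_st_nsc_def is_arg_min_def not_less)
  have sub: "subgraph (with_proj B) (with_proj ?G)" and symB: "sym (parcs B)"
    using nsc by (auto simp: st_nsc_def undirected_subgraph_def symmetric_def)
  have XV: "X \<subseteq> V" and BE: "parcs B \<subseteq> E"
    using sub by (auto simp: subgraph_def X_def V_def E_def)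
  have BX: "parcs B \<subseteq> X \<times> X"
  proof -
    have "wf_digraph (with_proj B)" using sub by blast
    then show ?thesis by (fastforce simp: wf_digraph_def X_def)
  qed
  have stX: "s \<in> X" "t \<in> X" using nsc by (auto simp: st_nsc_def X_def)
  have connB: "conn_in (parcs B) X"
    using nsc symB by (simp add: st_nsc_def connected_iff_conn_in X_def)
  then have connX: "conn_in E X"
    unfolding conn_in_def reach_in_def using rtrancl_mono[of "parcs B \<inter> X \<times> X" "E \<inter> X \<times> X"] BE by blast
  have nonsep: "V - X \<noteq> {}" "conn_in E (V - X)"
    using nsc connected_delete_nodes_iff[of ?G] symE
    by (auto simp: st_nsc_def non_separating_def V_def E_def X_def)
  \<comment> \<open>An empty remainder, which \<open>two_cut\<close> excludes, satisfies
    \<open>conn_in\<close> vacuously.\<close>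
  have "conn_in E (V - {s, t})" if "s \<noteq> t"
    using assms(4-6) that connected_delete_nodes_iff[of ?G "{s, t}"] symE
    by (auto simp: two_cut_def V_def E_def conn_in_def)
  then obtain q where q: "induced_path E q" "hd q = s" "last q = t" "set q \<subseteq> X" "conn_in E (V - set q)"
    using ex_non_separating_induced_path[OF XV connX stX nonsep] by blast

  \<comment> \<open>The induced path as a competing connector\<close>
  have qne: "q \<noteq> []" using q(1) by (simp add: induced_path_def)
  define P where "P = \<lparr> pverts = set q, parcs = E \<inter> set q \<times> set q \<rparr>"
  have Psub: "undirected_subgraph P ?G"
    using q(4) XV symE G.wf_digraph_axioms
    by (auto simp: undirected_subgraph_def subgraph_def P_def V_def E_def compatible_def
        symmetric_def sym_def wf_digraph_def)
  have "st_nsc ?G s t P"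
  proof -
    have "conn_in E (set q)"
    proof (rule conn_inI[OF symE, of _ "q ! 0"])
      fix x assume "x \<in> set q"
      then obtain i where "i < length q" "x = q ! i" by (auto simp: in_set_conv_nth)
      then show "(q ! 0, x) \<in> reach_in E (set q)"
        using induced_path_reach_in[OF q(1), of 0 i "set q"] by auto
    qed
    moreover have "sym (E \<inter> set q \<times> set q)" using symE by (auto simp: sym_def)
    ultimately have "Digraph_Component.connected (with_proj P)"
      using qne by (simp add: connected_iff_conn_in P_def conn_in_Restr)
    moreover have "s \<in> set q" "t \<in> set q" using q(2,3) qne by auto
    moreover have "Digraph_Component.connected (delete_nodes ?G (pverts P))"
      using connected_delete_nodes_iff[of ?G] symE q(4,5) nonsep(1)
      by (auto simp: V_def E_def P_def)
    ultimately show ?thesis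
      using Psub by (simp add: st_nsc_def non_separating_def P_def)
  qed
  from min[OF this] have le: "(\<Sum>v\<in>X. w v) \<le> (\<Sum>v\<in>set q. w v)"
    by (simp add: node_weight_def X_def P_def)
  \<comment> \<open>\<open>q\<close> runs inside \<open>X\<close>, and weights are positive, so a
    node of \<open>X\<close> missed by \<open>q\<close> would make \<open>P\<close> strictly lighter
    than \<open>B\<close>.\<close>
  have X: "X = set q"
  proof (rule ccontr)
    assume "X \<noteq> set q"
    then obtain x where x: "x \<in> X - set q" using q(4) by blast
    have pos: "0 < w v" if "v \<in> X" for v using assms(3)[of v] that XV by (auto simp only: V_def)
    have "finite X" using XV finV finite_subset by blast
    then have "(\<Sum>v\<in>set q. w v) < (\<Sum>v\<in>X. w v)"
      by (rule sum_strict_mono2[OF _ q(4) x]) (use x pos in \<open>auto intro: less_imp_le\<close>)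
    then show False using le by simp
  qed

  \<comment> \<open>Edges of the minimum connector\<close>
  have idx: "q ! i = q ! j \<longleftrightarrow> i = j" if "i < length q" "j < length q" for i j
    using that q(1) by (simp add: induced_path_def nth_eq_iff_index_eq)
  have adj: "(q ! i, q ! j) \<in> E \<longleftrightarrow> j = Suc i \<or> i = Suc j" if "i < length q" "j < length q" for i j
    using that q(1) by (simp add: induced_path_def)
  \<comment> \<open>So far \<open>B\<close> is only known to have the nodes of \<open>q\<close>. The
    grid has just one edge between the first \<open>k + 1\<close> of them and the rest, so the
    connected \<open>B\<close> must contain it.\<close>
  have arc: "(q ! k, q ! Suc k) \<in> parcs B" if k: "Suc k < length q" for k
  proof (rule ccontr)
    assume no: "(q ! k, q ! Suc k) \<notin> parcs B"
    let ?A = "{q ! i |i. i \<le> k}"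
    have "q ! 0 \<in> X" "q ! Suc k \<in> X" using k qne unfolding X by simp_all
    then have "(q ! 0, q ! Suc k) \<in> reach_in (parcs B) X"
      using connB unfolding conn_in_def by blast
    then have "q ! Suc k \<in> ?A"
    proof (rule reach_in_closed)
      fix u v assume uv: "(u, v) \<in> parcs B" "u \<in> ?A" "v \<in> X"
      then obtain i j where ij: "u = q ! i" "i \<le> k" "v = q ! j" "j < length q"
        using X by (auto simp: in_set_conv_nth)
      then have "j = Suc i \<or> i = Suc j" using adj[of i j] uv(1) BE k by auto
      moreover have "\<not> (i = k \<and> j = Suc k)" using no uv(1) ij by auto
      ultimately show "v \<in> ?A" using ij by force
    qed auto
    then show False using idx k by force
  qed
  have arc': "(q ! Suc k, q ! k) \<in> parcs B" if "Suc k < length q" for k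
    using arc[OF that] by (rule symD[OF symB])
  have steps: "\<exists>i. Suc i < length q \<and> (e = (q ! i, q ! Suc i) \<or> e = (q ! Suc i, q ! i))"
    if e: "e \<in> E \<inter> X \<times> X" for e
  proof -
    obtain u v where uv: "e = (u, v)" "u \<in> set q" "v \<in> set q" "(u, v) \<in> E"
      using e unfolding X by blast
    obtain i j where ij: "i < length q" "u = q ! i" "j < length q" "v = q ! j"
      using uv(2,3) by (metis in_set_conv_nth)
    then have "j = Suc i \<or> i = Suc j" using adj uv(4) by blast
    then show ?thesis using ij uv(1) by blast
  qed
  have arcs: "parcs B = E \<inter> X \<times> X"
  proof (intro equalityI subsetI)
    fix e assume "e \<in> E \<inter> X \<times> X"
    then show "e \<in> parcs B" using steps[of e] arc arc' by blast
  qed (use BE BX in auto)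
  have zip: "set (zip q (tl q)) = {(q ! k, q ! Suc k) |k. Suc k < length q}"
    by (auto simp: set_zip nth_tl)
  have arcs_zip: "parcs B = set (zip q (tl q)) \<union> (set (zip q (tl q)))\<inverse>"
  proof (intro equalityI subsetI)
    fix e assume "e \<in> parcs B"
    then show "e \<in> set (zip q (tl q)) \<union> (set (zip q (tl q)))\<inverse>"
      using steps[of e] unfolding zip arcs by blast
  next
    fix e assume "e \<in> set (zip q (tl q)) \<union> (set (zip q (tl q)))\<inverse>"
    then show "e \<in> parcs B" using arc arc' unfolding zip by blast
  qed
  \<comment> \<open>\<open>is_st_path\<close> asks for a path in \<open>B\<close> itself, so the
    translation to arc lists is applied with \<open>B\<close> as the ambient graph.\<close>
  have "induced_path (parcs B) q"
    using q(1) X unfolding arcs induced_path_def by auto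
  moreover have Bq: "pverts B = set q" using X by (simp add: X_def)
  ultimately have path: "pre_digraph.apath (with_proj B) s (zip q (tl q)) t"
    and path_verts: "pawalk_verts s (zip q (tl q)) = q"
    using induced_path_apath[of B q] unfolding q(2,3) by blast+
  have "is_st_path B s t"
    unfolding is_st_path_def
  proof (intro exI conjI)
    show "pverts B = set (pawalk_verts s (zip q (tl q)))" unfolding path_verts by (rule Bq)
  qed (fact path arcs_zip)+
  moreover have "induced_subgraph (with_proj B) (with_proj ?G)"
  proof (rule induced_subgraphI[OF sub])
    have "E \<inter> X \<times> X = {e \<in> E. fst e \<in> X \<and> snd e \<in> X}" by auto
    then show "arcs (with_proj B) = {e \<in> arcs (with_proj ?G).
        tail (with_proj ?G) e \<in> verts (with_proj B) \<and> head (with_proj ?G) e \<in> verts (with_proj B)}"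
      using arcs by (simp only: with_proj_simps X_def E_def)
  qed
  moreover have "non_separating ?G B" using nsc unfolding st_nsc_def by blast
  ultimately show ?thesis unfolding induced_st_path_def by blast
qed

end
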